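(* Suppose $2\le k\le d+1$ are integers. For every graph $G$, \[\omega^k_d(G)\le |V(G)|-\gamma^k_d(G)+(k-1).\]
   Context: A shortest path in a graph $G$ is a path between some vertices $u,v$ whose length (number of edges) equals the graph distance between $u$ and $v$. A set $S\subseteq V(G)$ is a $k,d$-clique in $G$ if every $k$-element subset of $S$ is contained in some shortest path of $G$ of length at most $d$ (sets with fewer than $k$ elements are vacuously $k,d$-cliques); $\omega^k_d(G)$ is the supremum of the sizes of $k,d$-cliques in $G$. A set $D\subseteq V(G)$ is $k,d$-dominating in $G$ if for every $v\in V(G)\setminus D$ there is a shortest path $P$ in $G$ of length at most $d$ containing $v$ with $|V(P)\cap D|\ge k-1$; $\gamma^k_d(G)$ is the minimum size of a $k,d$-dominating set in $G$. *)

theory Defs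
  imports "Graph_Theory.Pair_Digraph" "Graph_Theory.Shortest_Path"
    "HOL-Library.Extended_Nat" "HOL-Library.Extended_Real"
begin

text \<open>
  All infinite sets get size \<open>\<infinity>\<close>. When sizes are compared in \<^typ>\<open>ereal\<close>,
  \<open>\<infinity> - \<infinity> = \<infinity>\<close> by the library's convention.
\<close>

definition esize :: "'a set \<Rightarrow> enat" where
  "esize A = (if finite A then enat (card A) else \<infinity>)"

text \<open>
  The locale \<^locale>\<open>pair_bidirected_digraph\<close> is the library's notion of a simple graph
  (symmetric loop-free set of arcs, no parallel arcs) without any finiteness requirement.
\<close>

context pair_bidirected_digraph
begin

text \<open>With all arc weights equal to 1, \<open>\<mu>\<close> is the usual graph distance.\<close>

definition shortest_path :: "'a \<Rightarrow> ('a \<times> 'a) awalk \<Rightarrow> 'a \<Rightarrow> bool" where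
  "shortest_path u p v \<longleftrightarrow> apath u p v \<and> ereal (real (length p)) = \<mu> (\<lambda>_. 1) u v"

definition kd_clique :: "nat \<Rightarrow> nat \<Rightarrow> 'a set \<Rightarrow> bool" where
  "kd_clique k d S \<longleftrightarrow> S \<subseteq> pverts G \<and>
     (\<forall>T. T \<subseteq> S \<and> finite T \<and> card T = k \<longrightarrow>
        (\<exists>u p v. shortest_path u p v \<and> length p \<le> d \<and> T \<subseteq> set (pawalk_verts u p)))"

definition kd_clique_number :: "nat \<Rightarrow> nat \<Rightarrow> enat" where
  "kd_clique_number k d = (SUP S \<in> {S. kd_clique k d S}. esize S)"

definition kd_dominating :: "nat \<Rightarrow> nat \<Rightarrow> 'a set \<Rightarrow> bool" where
  "kd_dominating k d D \<longleftrightarrow> D \<subseteq> pverts G \<and>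
     (\<forall>x \<in> pverts G - D. \<exists>u p v. shortest_path u p v \<and> length p \<le> d \<and>
        x \<in> set (pawalk_verts u p) \<and> k - 1 \<le> card (set (pawalk_verts u p) \<inter> D))"

text \<open>
  The infimum is attained, since \<open>pverts G\<close> is dominating and \<^typ>\<open>enat\<close> is well-ordered.
\<close>

definition kd_domination_number :: "nat \<Rightarrow> nat \<Rightarrow> enat" where
  "kd_domination_number k d = (INF D \<in> {D. kd_dominating k d D}. esize D)"

end

end

theory Submission
  imports Defs
begin

text \<open>
  If \<open>S\<close> is a \<open>k,d\<close>-clique with at least \<open>k - 1\<close> vertices, keep \<open>k - 1\<close> of them as \<open>A\<close>
  and discard the others from the vertex set. The remaining set is \<open>k,d\<close>-dominating, because the shortest
  path through the \<open>k\<close>-set \<open>insert x A\<close> serves a discarded vertex \<open>x\<close>.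
\<close>

context pair_bidirected_digraph
begin

lemma kd_dominating_pverts: "kd_dominating k d (pverts G)"
  by (simp add: kd_dominating_def)

lemma kd_domination_number_le:
  assumes "kd_dominating k d D"
  shows "kd_domination_number k d \<le> esize D"
  using assms unfolding kd_domination_number_def by (intro INF_lower) simp

lemma kd_clique_imp_kd_dominating:
  assumes S: "kd_clique k d S" and A: "A \<subseteq> S" "finite A" "card A = k - 1" and "0 < k"
  shows "kd_dominating k d (pverts G - (S - A))"
  unfolding kd_dominating_def
proof (intro conjI ballI)
  have S_sub: "S \<subseteq> pverts G" using S by (simp add: kd_clique_def)
  fix x assume "x \<in> pverts G - (pverts G - (S - A))"
  then have x: "x \<in> S" "x \<notin> A" by auto
  have "insert x A \<subseteq> S" "finite (insert x A)" "card (insert x A) = k"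
    using x A \<open>0 < k\<close> by auto
  then obtain u p v where p: "shortest_path u p v" "length p \<le> d"
      "insert x A \<subseteq> set (pawalk_verts u p)"
    using S unfolding kd_clique_def by blast
  \<comment> \<open>Only \<open>S - A\<close> was removed, so all \<open>k - 1\<close> vertices of
    \<open>A\<close> count towards the domination of \<open>x\<close>.\<close>
  have "A \<subseteq> set (pawalk_verts u p) \<inter> (pverts G - (S - A))"
    using p(3) A(1) S_sub by auto
  then have "k - 1 \<le> card (set (pawalk_verts u p) \<inter> (pverts G - (S - A)))"
    unfolding A(3)[symmetric] by (intro card_mono) auto
  with p show "\<exists>u p v. shortest_path u p v \<and> length p \<le> d \<and> x \<in> set (pawalk_verts u p) \<and>
      k - 1 \<le> card (set (pawalk_verts u p) \<inter> (pverts G - (S - A)))"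
    by blast
qed auto

text \<open>The additive form avoids truncated subtraction on naturals.\<close>

lemma card_kd_clique_add_domination_number_le:
  assumes fin: "finite (pverts G)" and S: "kd_clique k d S" and "0 < k"
    and g: "kd_domination_number k d = enat g"
  shows "card S + g \<le> card (pverts G) + (k - 1)"
proof (cases "k - 1 \<le> card S")
  case True
  have S_sub: "S \<subseteq> pverts G" using S by (simp add: kd_clique_def)
  have finS: "finite S" using S_sub fin by (rule finite_subset)
  obtain A where A: "A \<subseteq> S" "finite A" "card A = k - 1"
    using True obtain_subset_with_card_n by metis
  have "enat g \<le> esize (pverts G - (S - A))"
    unfolding g[symmetric]
    using kd_clique_imp_kd_dominating[OF S A \<open>0 < k\<close>] by (rule kd_domination_number_le)
  also have "\<dots> = enat (card (pverts G) - (card S - (k - 1)))"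
  proof -
    have "card (pverts G - (S - A)) = card (pverts G) - card (S - A)"
      using finS S_sub by (intro card_Diff_subset) auto
    then show ?thesis using fin A by (simp add: esize_def card_Diff_subset)
  qed
  \<comment> \<open>Neither natural subtraction truncates, since \<open>k - 1\<close> \<le>
    \<open>card S\<close> \<le> \<open>card (pverts G)\<close>.\<close>
  finally show ?thesis
    using True card_mono[OF fin S_sub] by simp
next
  case False
  \<comment> \<open>Here \<open>S\<close> is too small to contain a suitable \<open>A\<close>, but
    the trivial dominating set suffices because \<open>card S < k - 1\<close>.\<close>
  have "enat g \<le> esize (pverts G)"
    unfolding g[symmetric] using kd_dominating_pverts by (rule kd_domination_number_le)
  with False fin show ?thesis by (simp add: esize_def)
qed

text \<open>Finiteness of the vertex set bounds both numbers, so the comparison in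
  \<open>ereal\<close> reduces to one between naturals.\<close>

lemma kd_clique_number_add_domination_number_le:
  assumes fin: "finite (pverts G)" and "0 < k"
  obtains w g where "kd_clique_number k d = enat w" "kd_domination_number k d = enat g"
    "w + g \<le> card (pverts G) + (k - 1)"
proof -
  have le: "kd_domination_number k d \<le> enat (card (pverts G))"
    using kd_domination_number_le[OF kd_dominating_pverts] fin by (simp add: esize_def)
  then obtain g where g: "kd_domination_number k d = enat g"
    by (cases "kd_domination_number k d") auto
  \<comment> \<open>By \<open>le\<close>, \<open>g\<close> is at most
    \<open>card (pverts G)\<close>, so this subtraction can be undone at the end.\<close>
  have "kd_clique_number k d \<le> enat (card (pverts G) + (k - 1) - g)"
    unfolding kd_clique_number_def
  proof (rule SUP_least)
    fix S assume "S \<in> {S. kd_clique k d S}"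
    then have S: "kd_clique k d S" by simp
    then have "finite S" using fin by (auto simp: kd_clique_def intro: finite_subset)
    with card_kd_clique_add_domination_number_le[OF fin S \<open>0 < k\<close> g]
    show "esize S \<le> enat (card (pverts G) + (k - 1) - g)" by (simp add: esize_def)
  qed
  then obtain w where "kd_clique_number k d = enat w" "w \<le> card (pverts G) + (k - 1) - g"
    by (cases "kd_clique_number k d") auto
  with g le show ?thesis by (intro that) auto
qed

end

theorem proposition2p2:
  fixes G :: "'a pair_pre_digraph" and k d :: nat
  assumes "2 \<le> k" and "k \<le> d + 1"
    and "pair_bidirected_digraph G"
  shows "ereal_of_enat (pair_bidirected_digraph.kd_clique_number G k d)
    \<le> ereal_of_enat (esize (pverts G))
        - ereal_of_enat (pair_bidirected_digraph.kd_domination_number G k d)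
        + ereal (real k - 1)"
proof -
  interpret pair_bidirected_digraph G by fact
  show ?thesis
  proof (cases "finite (pverts G)")
    case True
    obtain w g where "kd_clique_number k d = enat w" "kd_domination_number k d = enat g"
        "w + g \<le> card (pverts G) + (k - 1)"
      using kd_clique_number_add_domination_number_le[OF True, of k d] assms(1) by auto
    \<comment> \<open>Since \<open>2 \<le> k\<close>, the real \<open>real k - 1\<close> agrees with
      the natural number \<open>k - 1\<close>.\<close>
    with True assms(1) show ?thesis by (simp add: esize_def)
  next
    case False
    \<comment> \<open>The right-hand side is \<infinity>, even for an infinite domination number,
      because \<infinity> - \<infinity> = \<infinity> in \<open>ereal\<close>.\<close>
    then show ?thesis by (simp add: esize_def)
  qed
qed

end
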